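(* Let $p\ge 3$ be a prime with $\left(\frac{-1}{p}\right)=-1$ and let $1\le r\le p-1$ be an integer. Then for any integers $\alpha\ge 0$ and $n\ge 0$: (i) $$\sum_{m=0}^{\infty}\overline{R}_6^{\ast}\left(2p^{2\alpha}m+\frac{5p^{2\alpha}-1}{4}\right)q^m\equiv 2\psi(q)\psi(q^4)\pmod 3;$$ (ii) $$\overline{R}_6^{\ast}\left(2p^{2\alpha+1}(pn+r)+\frac{5p^{2\alpha+2}-1}{4}\right)\equiv 0\pmod 3.$$
   Context: An overpartition of a nonnegative integer $n$ is a partition of $n$ in which the first occurrence of each part size may be overlined. For a positive integer $\ell$, $\overline{R}_\ell^{\ast}(n)$ denotes the number of overpartitions of $n$ in which the non-overlined parts are $\ell$-regular, i.e. no non-overlined part is divisible by $\ell$ (overlined parts are unrestricted). With $f_h:=\prod_{m\ge 1}(1-q^{hm})$, the generating function is $\sum_{n\ge 0}\overline{R}_\ell^{\ast}(n)q^n=\frac{f_2f_\ell}{f_1^2}$. Ramanujan's theta function is $\psi(q):=\sum_{\nu\ge 0}q^{\nu(\nu+1)/2}=\frac{f_2^2}{f_1}$. A congruence between power series in $q$ modulo an integer means congruence of all corresponding coefficients. $\left(\frac{\cdot}{p}\right)$ is the Legendre symbol. *)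

theory Defs
  imports
    "HOL-Library.Multiset"
    "HOL-Number_Theory.Number_Theory"
    "HOL-Computational_Algebra.Formal_Power_Series"
begin

(* An overpartition is a pair (P, S): P is the multiset of all parts and S the set of those part
   sizes whose first occurrence is overlined. *)
definition overpartitions :: "nat \<Rightarrow> (nat multiset \<times> nat set) set" where
  "overpartitions n = {(P, S). (\<forall>k\<in>#P. 0 < k) \<and> sum_mset P = n \<and> S \<subseteq> set_mset P}"

(* Each size in S is overlined exactly once; its further occurrences are not overlined. *)
definition nonoverlined_parts :: "nat multiset \<times> nat set \<Rightarrow> nat multiset" where
  "nonoverlined_parts Q = fst Q - mset_set (snd Q)"

definition overR :: "nat \<Rightarrow> nat \<Rightarrow> nat" where
  "overR l n = card {Q \<in> overpartitions n. \<forall>k\<in>#nonoverlined_parts Q. \<not> l dvd k}"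

(* The infinite sum is taken in the topology of formal power series. *)
definition ramanujan_psi :: "int fps" where
  "ramanujan_psi = (\<Sum>\<nu>. fps_X ^ (\<nu> * (\<nu> + 1) div 2))"

definition fps_cong :: "int fps \<Rightarrow> int fps \<Rightarrow> int \<Rightarrow> bool" where
  "fps_cong F G M \<longleftrightarrow> (\<forall>n. [fps_nth F n = fps_nth G n] (mod M))"

(* overR counts a finite set, so card does not default to 0. *)
lemma finite_overpartitions: "finite (overpartitions n)"
proof -
  have le: "k \<le> n" if "k \<in># P" "sum_mset P = n" for k :: nat and P
    using that by (auto dest!: multi_member_split)
  have sz: "size P \<le> sum_mset P" if "\<forall>k\<in>#P. 0 < k" for P :: "nat multiset"
    using that by (induction P) auto
  have "overpartitions n \<subseteq>
      (\<Union>j\<le>n. {P. set_mset P \<subseteq> {..n} \<and> size P = j}) \<times> Pow {..n}"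
  proof
    fix Q assume Q: "Q \<in> overpartitions n"
    obtain P S where PS: "Q = (P, S)" by (cases Q)
    with Q have P: "\<forall>k\<in>#P. 0 < k" "sum_mset P = n" "S \<subseteq> set_mset P"
      by (simp_all add: overpartitions_def)
    have "set_mset P \<subseteq> {..n}" using le[OF _ P(2)] by blast
    moreover have "size P \<le> n" using sz[OF P(1)] P(2) by simp
    ultimately show "Q \<in> (\<Union>j\<le>n. {P. set_mset P \<subseteq> {..n} \<and> size P = j}) \<times> Pow {..n}"
      using PS P(3) by simp
  qed
  moreover have "finite ((\<Union>j\<le>n. {P. set_mset P \<subseteq> {..n} \<and> size P = j}) \<times> Pow {..n})"
    using finite_multisets_of_size[of "{..n}", unfolded multisets_of_size_def]
    by (intro finite_SigmaI finite_UN_I) auto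
  ultimately show ?thesis by (rule finite_subset)
qed

(* The series defining ramanujan_psi converges, so suminf is its actual sum. *)
lemma ramanujan_psi_sums:
  "(\<lambda>\<nu>. fps_X ^ (\<nu> * (\<nu> + 1) div 2)) sums ramanujan_psi"
proof -
  let ?t = "\<lambda>\<nu>::nat. \<nu> * (\<nu> + 1) div 2"
  let ?F = "Abs_fps (\<lambda>k. \<Sum>\<nu>\<le>k. if k = ?t \<nu> then 1 else 0) :: int fps"
  have ge: "\<nu> \<le> ?t \<nu>" for \<nu>
  proof -
    have "\<nu> * 2 \<le> \<nu> * (\<nu> + 1)" by (cases "\<nu> = 0") auto
    then have "\<nu> * 2 div 2 \<le> \<nu> * (\<nu> + 1) div 2" by (rule div_le_mono)
    then show ?thesis by simp
  qed
  have "(\<lambda>\<nu>. fps_X ^ ?t \<nu>) sums ?F"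
    unfolding sums_def
  proof (rule tendsto_fpsI)
    fix k
    have "fps_nth (\<Sum>\<nu><N. fps_X ^ ?t \<nu> :: int fps) k = fps_nth ?F k" if "N > k" for N
    proof -
      have "fps_nth (\<Sum>\<nu><N. fps_X ^ ?t \<nu> :: int fps) k = (\<Sum>\<nu><N. if k = ?t \<nu> then 1 else 0)"
        by (simp add: fps_sum_nth fps_X_power_nth)
      also have "\<dots> = (\<Sum>\<nu>\<le>k. if k = ?t \<nu> then 1 else 0)"
      proof (rule sum.mono_neutral_right)
        show "\<forall>\<nu>\<in>{..<N} - {..k}. (if k = ?t \<nu> then 1 else 0) = (0::int)"
        proof
          fix \<nu> assume "\<nu> \<in> {..<N} - {..k}"
          then have "k < ?t \<nu>" using ge[of \<nu>] by auto
          then show "(if k = ?t \<nu> then 1 else 0) = (0::int)" by auto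
        qed
      qed (use that in auto)
      finally show ?thesis by simp
    qed
    then show "\<forall>\<^sub>F N in sequentially.
        fps_nth (\<Sum>\<nu><N. fps_X ^ ?t \<nu> :: int fps) k = fps_nth ?F k"
      by (intro eventually_sequentiallyI[of "Suc k"]) auto
  qed
  then show ?thesis
    unfolding ramanujan_psi_def by (rule sums_summable[THEN summable_sums])
qed

end

theory Submission
  imports Defs "HOL-Computational_Algebra.Formal_Laurent_Series"
begin

text \<open>Modulo 3, the counting function is a number of representations by sums of two squares.

  Write $f_h = \prod_m (1 - q^{hm})$. The generating function of the overpartitions in question is
  $f_2 f_6 / f_1^2$, and $f_6 \equiv f_2^3$ modulo 3, so this series is congruent to $(f_2^2/f_1)^2$. Gauss's
  product $\psi(q) = f_2^2/f_1$ identifies this with $\psi(q)^2$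
  (\<open>overR_6_cong_psi_square\<close>). Since $8 T_i + 1 = (2i+1)^2$ for the triangular number $T_i$, the
  coefficient of $q^k$ in $\psi(q)^2$ counts the pairs of odd positive integers $a, b$ with
  $a^2 + b^2 = 8k + 2$. For the indices of the theorem, $8k + 2$ is $p^{2\alpha}(16m + 10)$ in part
  (i) and $p^{2\alpha+1}$ times a number prime to $p$ in part (ii).

  As $-1$ is not a square modulo $p$, the prime $p$ divides $a^2 + b^2$ only if it divides both $a$
  and $b$. Hence a factor $p^2$ can be removed without changing the number of representations, and a
  number divisible by $p$ to an odd power has none; the second fact is part (ii). For part (i) there
  remains the number of ways to write $16m + 10$ as a sum of two odd squares. By
  $(x+y)^2 + (x-y)^2 = 2(x^2+y^2)$ it is twice the number of ways to write $8m + 5$ as an odd square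
  plus an even one (\<open>odd_square_reps_double\<close>), and that is the coefficient of $q^m$ in
  $\psi(q)\psi(q^4)$.

  Infinite products are replaced throughout by finite ones, compared up to a degree that exceeds
  the coefficient of interest. Gauss's product then follows from a finite identity of Shanks, which
  telescopes (\<open>shanks_identity\<close>).\<close>

section \<open>Truncated congruences of power series\<close>

text \<open>This is congruence modulo the ideal generated by \<open>M\<close> and $q^N$: it carries both truncation,
  as the case \<open>M = 0\<close>, and reduction modulo 3.\<close>
definition cong_upto :: "int \<Rightarrow> nat \<Rightarrow> int fps \<Rightarrow> int fps \<Rightarrow> bool" where
  "cong_upto M N F G \<longleftrightarrow> (\<forall>k<N. [fps_nth F k = fps_nth G k] (mod M))"

lemma cong_upto_refl [simp]: "cong_upto M N F F"
  by (simp add: cong_upto_def)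

lemma cong_upto_sym: "cong_upto M N F G \<Longrightarrow> cong_upto M N G F"
  by (simp add: cong_upto_def cong_sym)

lemma cong_upto_trans [trans]:
  "cong_upto M N F G \<Longrightarrow> cong_upto M N G H \<Longrightarrow> cong_upto M N F H"
  unfolding cong_upto_def using cong_trans by blast

lemma cong_upto_exact: "cong_upto 0 N F G \<Longrightarrow> cong_upto M N F G"
  by (simp add: cong_upto_def)

lemma cong_upto_mult:
  assumes "cong_upto M N F F'" and "cong_upto M N G G'"
  shows "cong_upto M N (F * G) (F' * G')"
  unfolding cong_upto_def fps_mult_nth
  using assms by (auto intro!: cong_sum cong_mult simp: cong_upto_def)

lemma cong_upto_prod:
  assumes "\<And>a. a \<in> A \<Longrightarrow> cong_upto M N (f a) (g a)"
  shows "cong_upto M N (\<Prod>a\<in>A. f a) (\<Prod>a\<in>A. g a)"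
  using assms by (induction A rule: infinite_finite_induct) (auto intro: cong_upto_mult)

text \<open>A series with constant term 1 is a unit, so this holds without passing to a field: each
  coefficient of \<open>F\<close> is determined by the product and by the earlier coefficients of \<open>F\<close>.\<close>
lemma cong_upto_cancel:
  assumes "fps_nth H 0 = 1" and "cong_upto M N (H * F) (H * G)"
  shows "cong_upto M N F G"
proof -
  have "[fps_nth F k = fps_nth G k] (mod M)" if "k < N" for k
    using that
  proof (induction k rule: less_induct)
    case (less k)
    let ?tail = "\<lambda>F. \<Sum>i=1..k. fps_nth H i * fps_nth F (k - i)"
    have split: "fps_nth (H * F) k = fps_nth F k + ?tail F" for F
      using assms(1) by (simp add: fps_mult_nth sum.atLeast_Suc_atMost)
    have "[?tail F = ?tail G] (mod M)"
      using less by (intro cong_sum cong_mult) auto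
    moreover have "[fps_nth F k + ?tail F = fps_nth G k + ?tail G] (mod M)"
      using assms(2) less.prems by (simp only: cong_upto_def split [symmetric])
    ultimately have "[(fps_nth F k + ?tail F) - ?tail F = (fps_nth G k + ?tail G) - ?tail G] (mod M)"
      by (intro cong_diff)
    then show ?case by simp
  qed
  then show ?thesis by (simp add: cong_upto_def)
qed

lemma cong_upto_one_minus_X_power:
  "N \<le> a \<Longrightarrow> cong_upto M N (1 - fps_X ^ a) 1"
  by (auto simp: cong_upto_def fps_X_power_nth)

lemma cong_upto_prod_truncate:
  assumes "finite A" and "B \<subseteq> A" and "\<And>a. a \<in> A - B \<Longrightarrow> N \<le> f a"
  shows "cong_upto M N (\<Prod>a\<in>A. 1 - fps_X ^ f a) (\<Prod>a\<in>B. 1 - fps_X ^ f a)"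
proof -
  have "(\<Prod>a\<in>A. 1 - fps_X ^ f a) = (\<Prod>a\<in>B. 1 - fps_X ^ f a) * (\<Prod>a\<in>A - B. 1 - fps_X ^ f a :: int fps)"
    using assms(1,2) by (metis prod.subset_diff mult.commute)
  moreover have "cong_upto M N (\<Prod>a\<in>A - B. 1 - fps_X ^ f a) (\<Prod>a\<in>A - B. 1)"
    using assms(3) by (intro cong_upto_prod cong_upto_one_minus_X_power) auto
  ultimately show ?thesis
    using cong_upto_mult[OF cong_upto_refl] by fastforce
qed

text \<open>The binomial coefficients between the outer terms of a cube are divisible by 3.\<close>
lemma cong_upto_cube: "cong_upto 3 N ((1 - fps_X ^ a) ^ 3) (1 - fps_X ^ (3 * a))"
proof -
  have "(1 - x) ^ 3 = 1 - x ^ 3 + 3 * (x ^ 2 - x)" for x :: "int fps"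
    by (simp add: power3_eq_cube power2_eq_square algebra_simps)
  then have eq: "(1 - fps_X ^ a) ^ 3 =
      1 - fps_X ^ (3 * a) + fps_const 3 * ((fps_X ^ a) ^ 2 - fps_X ^ a :: int fps)"
    by (simp add: power_mult [symmetric] mult.commute numeral_fps_const)
  show ?thesis unfolding eq by (auto simp: cong_upto_def cong_iff_dvd_diff simp del: fps_const_sub)
qed

lemma cong_upto_prod_cube:
  "cong_upto 3 N ((\<Prod>a\<in>A. 1 - fps_X ^ f a) ^ 3) (\<Prod>a\<in>A. 1 - fps_X ^ (3 * f a))"
  unfolding prod_power_distrib by (intro cong_upto_prod cong_upto_cube)

section \<open>Gauss's product for the theta function\<close>

text \<open>Shanks's finite form of Gauss's product, cleared of denominators: divided by
  $\prod_{k<n} (1 - q^{2k+1})$, it reads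
  $\sum_{i<2n} q^{T_i} = \sum_{s<n} (P_n/P_s)\, q^{s(2n+1)}$ with
  $P_n = \prod_{k=1}^n (1-q^{2k})/(1-q^{2k-1})$. Only the summand at \<open>s = 0\<close> has terms of degree
  at most \<open>2*n\<close>, which is why the identity computes \<open>\<psi>\<close> to that degree.

  Let \<open>H n s\<close> be the summand. Passing from \<open>n\<close> to \<open>n + 1\<close> multiplies it by
  $q^{2s}(1 - q^{2n+2})$, and the difference to $(1 - q^{2n+1})$ times the old summand telescopes in
  \<open>s\<close>; the upper boundary term and the new summand at \<open>s = n\<close> account for the two new powers
  of \<open>q\<close> on the left.\<close>
lemma shanks_identity:
  fixes q :: "'a::comm_ring_1"
  shows "(\<Sum>i<2*n. q ^ (i * (i + 1) div 2)) * (\<Prod>k<n. 1 - q ^ (2*k + 1)) =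
    (\<Sum>s<n. (\<Prod>k=s+1..n. 1 - q ^ (2*k)) * (\<Prod>k<s. 1 - q ^ (2*k + 1)) * q ^ (s * (2*n + 1)))"
proof -
  define A where "A n = (\<Sum>i<2*n. q ^ (i * (i + 1) div 2))" for n
  define D where "D n = (\<Prod>k<n. 1 - q ^ (2*k + 1))" for n
  define H where "H n s = (\<Prod>k=s+1..n. 1 - q ^ (2*k)) * D s * q ^ (s * (2*n + 1))" for n s
  have A_Suc: "A (Suc n) = A n + q ^ (n * (2*n + 1)) + q ^ ((n + 1) * (2*n + 1))" for n
  proof -
    have "2 * n * (2 * n + 1) div 2 = n * (2*n + 1)" by simp
    moreover have "(2 * n + 1) * (2 * n + 1 + 1) div 2 = (n + 1) * (2*n + 1)" by simp
    moreover have "2 * Suc n = Suc (2*n + 1)" "2*n + 1 = Suc (2*n)" by simp_all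
    ultimately show ?thesis unfolding A_def by (simp only: sum.lessThan_Suc)
  qed
  have D_Suc: "D (Suc n) = D n * (1 - q ^ (2*n) * q)" for n
    by (simp add: D_def mult.commute)
  have telescope: "H (Suc n) s - (1 - q ^ (2*n) * q) * H n s =
      H n (Suc s) * (1 - q ^ (2 * Suc s)) - H n s * (1 - q ^ (2*s))" if "s < n" for n s
  proof -
    define E where "E = (\<Prod>k=Suc (Suc s)..n. 1 - q ^ (2*k))"
    define a b W where "a = q ^ (2*s)" and "b = q ^ (2*n)" and "W = q ^ (s * (2*n + 1))"
    have powers: "q ^ (2 * Suc s) = a * q * q" "q ^ (2 * Suc n) = b * q * q"
      by (simp_all add: a_def b_def mult_ac)
    have shift: "q ^ (s * (2 * Suc n + 1)) = W * a" "q ^ (Suc s * (2*n + 1)) = W * (b * q)"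
      unfolding a_def b_def W_def
      by (simp_all only: power_add [symmetric] power_Suc2 [symmetric]) (simp_all add: algebra_simps)
    have E1: "(\<Prod>k=s+1..n. 1 - q ^ (2*k)) = (1 - a * q * q) * E"
      using that by (simp only: E_def Suc_eq_plus1 [symmetric] Suc_le_eq prod.atLeast_Suc_atMost powers)
    have E2: "(\<Prod>k=s+1..Suc n. 1 - q ^ (2*k)) = (1 - b * q * q) * ((1 - a * q * q) * E)"
      using that E1 powers by (simp only: prod.nat_ivl_Suc')
    have E3: "(\<Prod>k=Suc s+1..n. 1 - q ^ (2*k)) = E"
      by (simp add: E_def)
    show ?thesis
      unfolding H_def E1 E2 E3 shift powers D_Suc
      unfolding a_def [symmetric] b_def [symmetric] W_def [symmetric]
      by (simp add: algebra_simps)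
  qed
  have "A n * D n = (\<Sum>s<n. H n s)" for n
  proof (induction n)
    case 0
    show ?case by (simp add: A_def)
  next
    case (Suc n)
    define b Q where "b = q ^ (2*n)" and "Q = q ^ (n * (2*n + 1))"
    have Q1: "q ^ ((n + 1) * (2*n + 1)) = Q * b * q"
      unfolding b_def Q_def
      by (simp only: power_add [symmetric] power_Suc2 [symmetric]) (simp add: algebra_simps)
    have Q2: "q ^ (n * (2 * Suc n + 1)) = Q * b"
      unfolding b_def Q_def by (simp only: power_add [symmetric]) (simp add: algebra_simps)
    have H_last: "H (Suc n) n = (1 - b * q * q) * D n * (Q * b)"
      unfolding H_def Q2 by (simp add: b_def mult_ac)
    have "(\<Sum>s<n. H (Suc n) s) - (1 - b * q) * (\<Sum>s<n. H n s) =
        (\<Sum>s<n. H n (Suc s) * (1 - q ^ (2 * Suc s)) - H n s * (1 - q ^ (2*s)))"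
      unfolding sum_distrib_left sum_subtractf [symmetric] b_def
      by (intro sum.cong) (use telescope in auto)
    also have "\<dots> = H n n * (1 - q ^ (2*n)) - H n 0 * (1 - q ^ (2*0))"
      by (rule sum_lessThan_telescope)
    also have "\<dots> = D n * Q * (1 - b)"
      by (simp add: H_def Q_def b_def)
    finally have sum_H: "(\<Sum>s<n. H (Suc n) s) = (1 - b * q) * (\<Sum>s<n. H n s) + D n * Q * (1 - b)"
      by (simp add: algebra_simps)
    have "A (Suc n) * D (Suc n) = (1 - b * q) * (A n * D n) + (Q + Q * b * q) * (D n * (1 - b * q))"
      unfolding A_Suc Q1 Q_def [symmetric] D_Suc b_def [symmetric] by (simp add: algebra_simps)
    also have "\<dots> = (\<Sum>s<n. H (Suc n) s) + (1 - b * q * q) * D n * (Q * b)"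
      unfolding Suc.IH sum_H by (simp add: algebra_simps)
    also have "\<dots> = (\<Sum>s<Suc n. H (Suc n) s)"
      by (simp add: H_last)
    finally show ?case .
  qed
  then show ?thesis by (simp only: A_def D_def H_def)
qed

lemma prod_split_parity:
  fixes f :: "nat \<Rightarrow> 'a::comm_monoid_mult"
  shows "(\<Prod>k\<in>{1..2*n}. f k) = (\<Prod>k<n. f (2*k + 1)) * (\<Prod>k=1..n. f (2*k))"
proof (induction n)
  case (Suc n)
  have "2 * Suc n = Suc (Suc (2*n))" by simp
  then have "(\<Prod>k\<in>{1..2 * Suc n}. f k) = (\<Prod>k\<in>{1..2*n}. f k) * f (2*n + 1) * f (2 * Suc n)"
    by (simp add: mult_ac)
  then show ?case using Suc.IH by (simp add: mult_ac)
qed simp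

lemma ramanujan_psi_nth:
  assumes "k < N"
  shows "fps_nth ramanujan_psi k = fps_nth (\<Sum>\<nu><N. fps_X ^ (\<nu> * (\<nu> + 1) div 2)) k"
proof -
  let ?S = "\<lambda>N. \<Sum>\<nu><N. fps_X ^ (\<nu> * (\<nu> + 1) div 2) :: int fps"
  have "eventually (\<lambda>N. fps_nth (?S N) k = fps_nth ramanujan_psi k) sequentially"
    using ramanujan_psi_sums unfolding sums_def tendsto_fps_iff by blast
  then obtain N0 where N0: "\<And>M. M \<ge> N0 \<Longrightarrow> fps_nth (?S M) k = fps_nth ramanujan_psi k"
    unfolding eventually_sequentially by blast
  have stable: "fps_nth (?S (N + j)) k = fps_nth (?S N) k" for j
  proof (induction j)
    case (Suc j)
    have "(N + j) * 2 div 2 \<le> (N + j) * (N + j + 1) div 2"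
      using assms by (intro div_le_mono mult_le_mono2) simp
    then have "N + j \<le> (N + j) * (N + j + 1) div 2" by simp
    moreover have "k < N + j" using assms by simp
    ultimately have "k < (N + j) * (N + j + 1) div 2" by (rule order.strict_trans2[rotated])
    then have "fps_nth (fps_X ^ ((N + j) * (N + j + 1) div 2) :: int fps) k = 0"
      unfolding fps_X_power_nth by (simp only: less_imp_neq if_False)
    with Suc show ?case by (simp only: add_Suc_right sum.lessThan_Suc fps_add_nth add_0_right)
  qed simp
  show ?thesis using N0[of "N + N0"] stable[of N0] by simp
qed

text \<open>Gauss's identity $\psi(q) f_1 = f_2^2$, truncated. For positive \<open>n\<close>, the partial sum of \<open>\<psi>\<close> in
  \<open>shanks_identity\<close> is correct in all degrees up to \<open>2*n\<close>; for \<open>n = 0\<close> that sum is empty.\<close>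
lemma ramanujan_psi_product:
  assumes "n > 0"
  shows "cong_upto 0 (2*n + 1) (ramanujan_psi * (\<Prod>k\<in>{1..2*n}. 1 - fps_X ^ k))
           ((\<Prod>k\<in>{1..n}. 1 - fps_X ^ (2*k)) ^ 2)"
proof -
  define E where "E = (\<Prod>k=1..n. 1 - fps_X ^ (2*k) :: int fps)"
  define D where "D = (\<Prod>k<n. 1 - fps_X ^ (2*k + 1) :: int fps)"
  let ?A = "\<Sum>i<2*n. fps_X ^ (i * (i + 1) div 2) :: int fps"
  let ?H = "\<lambda>s. (\<Prod>k=s+1..n. 1 - fps_X ^ (2*k)) * (\<Prod>k<s. 1 - fps_X ^ (2*k + 1)) * fps_X ^ (s * (2*n + 1)) :: int fps"
  have psi: "cong_upto 0 (2*n + 1) ramanujan_psi ?A"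
  proof -
    have "fps_nth ramanujan_psi k = fps_nth ?A k" if "k < 2*n + 1" for k
    proof -
      \<comment> \<open>The next exponent, \<open>n * (2*n + 1)\<close>, is already beyond \<open>2*n\<close>.\<close>
      have "2*n * (2*n + 1) div 2 = n * (2*n + 1)" by simp
      moreover have "1 * (2*n + 1) \<le> n * (2*n + 1)"
        using assms by (intro mult_le_mono1) simp
      ultimately have "k \<noteq> 2*n * (2*n + 1) div 2" using that by (metis leD mult_1)
      moreover have "fps_nth ramanujan_psi k = 
          fps_nth (?A + fps_X ^ (2*n * (2*n + 1) div 2)) k"
        using ramanujan_psi_nth[OF that] by simp
      ultimately show ?thesis by (simp add: fps_X_power_nth)
    qed
    then show ?thesis by (simp add: cong_upto_def)
  qed
  have "?A * D = (\<Sum>s<n. ?H s)"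
    unfolding D_def by (rule shanks_identity)
  also have "\<dots> = E + (\<Sum>s\<in>{1..<n}. ?H s)"
    using assms by (simp add: E_def lessThan_atLeast0 sum.atLeast_Suc_lessThan)
  finally have AD: "?A * D = E + (\<Sum>s\<in>{1..<n}. ?H s)" .
  \<comment> \<open>The summands other than the first start in degree \<open>2*n + 1\<close> or higher.\<close>
  have "fps_nth (?H s) k = 0" if "k < 2*n + 1" "s \<in> {1..<n}" for s k
  proof -
    have "1 * (2*n + 1) \<le> s * (2*n + 1)"
      using that by (intro mult_le_mono1) simp
    then have "k < s * (2*n + 1)" using that(1) by (metis mult_1 order.strict_trans2)
    then show ?thesis unfolding fps_X_power_mult_right_nth by (simp only: if_True)
  qed
  then have "cong_upto 0 (2*n + 1) (?A * D) E"
    unfolding AD by (simp add: cong_upto_def fps_sum_nth)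
  moreover have "cong_upto 0 (2*n + 1) (ramanujan_psi * D) (?A * D)"
    using psi by (rule cong_upto_mult) simp
  ultimately have "cong_upto 0 (2*n + 1) (ramanujan_psi * D) E"
    by (rule cong_upto_trans[rotated])
  then have "cong_upto 0 (2*n + 1) (ramanujan_psi * D * E) (E * E)"
    by (rule cong_upto_mult) simp
  moreover have "(\<Prod>k\<in>{1..2*n}. 1 - fps_X ^ k :: int fps) = D * E"
    unfolding D_def E_def by (rule prod_split_parity)
  ultimately show ?thesis
    by (simp add: E_def power2_eq_square mult.assoc)
qed

section \<open>The generating function of restricted overpartitions\<close>

lemma prod_one_plus_X_power_nth:
  assumes "finite A"
  shows "fps_nth (\<Prod>a\<in>A. 1 + fps_X ^ a) n = int (card {S \<in> Pow A. \<Sum>S = n})"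
proof -
  have "(\<Prod>a\<in>A. 1 + fps_X ^ a) = (\<Sum>S\<in>Pow A. fps_X ^ (\<Sum>S) :: int fps)"
    using prod_add[OF assms, of "\<lambda>a. fps_X ^ a :: int fps" "\<lambda>_. 1"]
    by (simp add: add.commute power_sum)
  then have "fps_nth (\<Prod>a\<in>A. 1 + fps_X ^ a) n = (\<Sum>S\<in>Pow A. if \<Sum>S = n then 1 else (0::int))"
    by (simp add: fps_sum_nth fps_X_power_nth eq_commute)
  also have "\<dots> = int (card {S \<in> Pow A. \<Sum>S = n})"
    using assms by (simp add: sum.If_cases Int_def)
  finally show ?thesis .
qed

definition partitions_into :: "nat set \<Rightarrow> nat \<Rightarrow> nat multiset set" where
  "partitions_into A n = {M. set_mset M \<subseteq> A \<and> sum_mset M = n}"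

lemma finite_partitions_into:
  assumes "0 \<notin> A"
  shows "finite (partitions_into A n)"
proof -
  have "(\<lambda>M. (M, {})) ` partitions_into A n \<subseteq> overpartitions n"
  proof (rule image_subsetI)
    fix M assume M: "M \<in> partitions_into A n"
    have "set_mset M \<subseteq> A" using M by (simp add: partitions_into_def)
    then have "\<forall>k\<in>#M. 0 < k" using assms by (auto intro!: gr0I)
    with M show "(M, {}) \<in> overpartitions n" 
      by (simp add: partitions_into_def overpartitions_def)
  qed
  then have "finite ((\<lambda>M. (M, {} :: nat set)) ` partitions_into A n)"
    using finite_overpartitions finite_subset by blast
  then show ?thesis by (rule finite_imageD) (simp add: inj_on_def)
qed

definition partitions_fps :: "nat set \<Rightarrow> int fps" where
  "partitions_fps A = Abs_fps (\<lambda>n. int (card (partitions_into A n)))"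

text \<open>Partitions in which the part \<open>a\<close> occurs correspond, by removing one copy of it, to arbitrary
  partitions of \<open>n - a\<close>.\<close>
lemma partitions_fps_insert:
  assumes "0 \<notin> insert a A" and "a \<notin> A"
  shows "partitions_fps (insert a A) * (1 - fps_X ^ a) = partitions_fps A"
proof (rule fps_ext)
  fix n
  let ?P = "partitions_into (insert a A)"
  have split: "?P n = partitions_into A n \<union> (if a \<le> n then add_mset a ` ?P (n - a) else {})"
  proof (intro equalityI subsetI)
    fix M assume M: "M \<in> ?P n"
    show "M \<in> partitions_into A n \<union> (if a \<le> n then add_mset a ` ?P (n - a) else {})"
    proof (cases "a \<in># M")
      case True
      then obtain M' where "M = add_mset a M'" by (rule mset_add)
      with M show ?thesis by (auto simp: partitions_into_def)
    qed (use M in \<open>auto simp: partitions_into_def\<close>)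
  qed (auto simp: partitions_into_def split: if_splits)
  have "card (?P n) = card (partitions_into A n) + (if a \<le> n then card (?P (n - a)) else 0)"
  proof -
    have "card (add_mset a ` ?P (n - a)) = card (?P (n - a))"
      by (rule card_image) (simp add: inj_on_def)
    moreover have "partitions_into A n \<inter> add_mset a ` ?P (n - a) = {}"
    proof -
      have "add_mset a M \<notin> partitions_into A n" for M
        using assms(2) by (simp add: partitions_into_def)
      then show ?thesis by blast
    qed
    moreover have "finite (?P (n - a))" "finite (partitions_into A n)"
      using assms(1) by (simp_all add: finite_partitions_into)
    ultimately show ?thesis
      by (subst split) (simp add: card_Un_disjoint)
  qed
  then show "fps_nth (partitions_fps (insert a A) * (1 - fps_X ^ a)) n = fps_nth (partitions_fps A) n"
    by (simp add: partitions_fps_def right_diff_distrib fps_X_power_mult_right_nth)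
qed

lemma partitions_fps_product:
  assumes "finite A" and "0 \<notin> A"
  shows "partitions_fps A * (\<Prod>a\<in>A. 1 - fps_X ^ a) = 1"
  using assms
proof (induction A rule: finite_induct)
  case empty
  have "partitions_into {} n = (if n = 0 then {{#}} else {})" for n
    by (auto simp: partitions_into_def)
  then show ?case by (simp add: partitions_fps_def fps_eq_iff)
next
  case (insert a A)
  then have "partitions_fps (insert a A) * (1 - fps_X ^ a) = partitions_fps A"
    by (intro partitions_fps_insert) auto
  with insert show ?case by (simp flip: mult.assoc)
qed

text \<open>Separating the overlined parts from the others turns an overpartition into a pair of independent
  objects: a set \<open>S\<close> and a multiset \<open>M\<close> of parts not divisible by \<open>l\<close>. The bound \<open>N\<close> only
  makes the supply of parts finite.\<close>
lemma overR_eq_card_pairs: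
  assumes "n \<le> N"
  shows "overR l n = card {(M, S). set_mset M \<subseteq> {k \<in> {1..N}. \<not> l dvd k} \<and> S \<subseteq> {1..N} \<and>
           sum_mset M + \<Sum>S = n}" (is "_ = card ?R")
proof -
  let ?L = "{Q \<in> overpartitions n. \<forall>k\<in>#nonoverlined_parts Q. \<not> l dvd k}"
  have sum_mset_set: "sum_mset (mset_set S) = \<Sum>S" for S :: "nat set"
    by (simp add: sum_unfold_sum_mset)
  have part_le: "k \<le> sum_mset P" if "k \<in># P" for k :: nat and P
    using that by (auto dest!: multi_member_split)
  have "bij_betw (\<lambda>(P, S). (P - mset_set S, S)) ?L ?R"
  proof (rule bij_betw_byWitness[where f' = "\<lambda>(M, S). (M + mset_set S, S)"])
    have restore: "P - mset_set S + mset_set S = P" if "S \<subseteq> set_mset P" for P :: "nat multiset" and S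
    proof -
      have "mset_set S \<subseteq># mset_set (set_mset P)"
        using that by (simp add: subset_imp_msubset_mset_set)
      then have "mset_set S \<subseteq># P"
        using mset_set_set_mset_msubset subset_mset.order_trans by blast
      then show ?thesis by simp
    qed
    show "\<forall>Q\<in>?L. (\<lambda>(M, S). (M + mset_set S, S)) ((\<lambda>(P, S). (P - mset_set S, S)) Q) = Q"
      using restore by (auto simp: overpartitions_def)
    show "\<forall>Q\<in>?R. (\<lambda>(P, S). (P - mset_set S, S)) ((\<lambda>(M, S). (M + mset_set S, S)) Q) = Q"
      by auto
    show "(\<lambda>(P, S). (P - mset_set S, S)) ` ?L \<subseteq> ?R"
    proof (clarify)
      fix P S assume Q: "(P, S) \<in> overpartitions n" 
        and reg: "\<forall>k\<in>#nonoverlined_parts (P, S). \<not> l dvd k"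
      then have P: "\<forall>k\<in>#P. 0 < k" "sum_mset P = n" "S \<subseteq> set_mset P"
        by (simp_all add: overpartitions_def)
      have range: "k \<in> {1..N}" if "k \<in># P" for k
      proof -
        have "0 < k" "k \<le> n" using that P part_le by auto
        then show ?thesis using assms by simp
      qed
      have "sum_mset (P - mset_set S) + \<Sum>S = n"
        using P(2) restore[OF P(3)] by (metis sum_mset.union sum_mset_set)
      moreover have "set_mset (P - mset_set S) \<subseteq> {k \<in> {1..N}. \<not> l dvd k}"
        using reg range by (auto simp: nonoverlined_parts_def dest: in_diffD)
      moreover have "S \<subseteq> {1..N}" using P(3) range by blast
      ultimately show "set_mset (P - mset_set S) \<subseteq> {k \<in> {1..N}. \<not> l dvd k} \<and> S \<subseteq> {1..N} \<and>
           sum_mset (P - mset_set S) + \<Sum>S = n" by blast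
    qed
    show "(\<lambda>(M, S). (M + mset_set S, S)) ` ?R \<subseteq> ?L"
    proof (clarify)
      fix M S assume MS: "set_mset M \<subseteq> {k \<in> {1..N}. \<not> l dvd k}" "S \<subseteq> {1..N}" "n = sum_mset M + \<Sum>S"
      then have "finite S" using finite_subset by blast
      then have "set_mset (M + mset_set S) = set_mset M \<union> S" by simp
      moreover have "\<forall>k\<in>set_mset M \<union> S. 0 < k" using MS by (auto simp: subset_iff Suc_le_eq)
      ultimately show "(M + mset_set S, S) \<in> overpartitions (sum_mset M + \<Sum>S) \<and>
          (\<forall>k\<in>#nonoverlined_parts (M + mset_set S, S). \<not> l dvd k)"
        using MS by (auto simp: overpartitions_def nonoverlined_parts_def sum_mset_set)
    qed
  qed
  then show ?thesis unfolding overR_def by (rule bij_betw_same_card)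
qed

text \<open>The generating function $\prod_k (1+q^k) / \prod_{l \nmid k} (1-q^k)$, truncated and without
  denominators.\<close>
lemma overR_fps_product:
  "cong_upto 0 (Suc N) (Abs_fps (\<lambda>n. int (overR l n)) * (\<Prod>k\<in>{k\<in>{1..N}. \<not> l dvd k}. 1 - fps_X ^ k))
     (\<Prod>k\<in>{1..N}. 1 + fps_X ^ k)"
proof -
  let ?A = "{k\<in>{1..N}. \<not> l dvd k}"
  let ?D = "\<Prod>k\<in>{1..N}. 1 + fps_X ^ k :: int fps"
  let ?subsets = "\<lambda>j. {S \<in> Pow {1..N}. \<Sum>S = j}"
  have "int (overR l n) = fps_nth (partitions_fps ?A * ?D) n" if "n < Suc N" for n
  proof -
    let ?B = "\<lambda>i. partitions_into ?A i \<times> ?subsets (n - i)"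
    have "overR l n = card (\<Union>i\<in>{0..n}. ?B i)"
    proof (subst overR_eq_card_pairs[of n N])
      show "card {(M, S). set_mset M \<subseteq> ?A \<and> S \<subseteq> {1..N} \<and> sum_mset M + \<Sum>S = n} = card (\<Union>i\<in>{0..n}. ?B i)"
        by (rule arg_cong[where f = card]) (auto simp: partitions_into_def)
    qed (use that in simp)
    also have "\<dots> = (\<Sum>i=0..n. card (?B i))"
    proof (rule card_UN_disjoint)
      show "\<forall>i\<in>{0..n}. finite (?B i)"
        by (auto intro!: finite_cartesian_product finite_partitions_into)
    qed (auto simp: partitions_into_def)
    finally show ?thesis
      by (simp only: fps_mult_nth prod_one_plus_X_power_nth finite_atLeastAtMost card_cartesian_product)
         (simp add: partitions_fps_def)
  qed
  then have "cong_upto 0 (Suc N) (Abs_fps (\<lambda>n. int (overR l n))) (partitions_fps ?A * ?D)"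
    by (simp add: cong_upto_def)
  then have "cong_upto 0 (Suc N) (Abs_fps (\<lambda>n. int (overR l n)) * (\<Prod>k\<in>?A. 1 - fps_X ^ k))
      (partitions_fps ?A * ?D * (\<Prod>k\<in>?A. 1 - fps_X ^ k))"
    by (rule cong_upto_mult) simp
  moreover have "partitions_fps ?A * ?D * (\<Prod>k\<in>?A. 1 - fps_X ^ k) = ?D"
  proof -
    have "partitions_fps ?A * (\<Prod>k\<in>?A. 1 - fps_X ^ k) = 1"
      by (rule partitions_fps_product) auto
    then show ?thesis by (simp add: mult.assoc mult.left_commute)
  qed
  ultimately show ?thesis by (simp only:)
qed

text \<open>Multiplied by $f_1^2$, both sides become $f_2^4$: the left one since $f_2 f_6 \equiv f_2^4$
  modulo 3, the right one by Gauss's identity. The factor $f_1^2$ has constant term 1 and cancels.\<close>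
lemma overR_6_cong_psi_square:
  "[int (overR 6 k) = fps_nth (ramanujan_psi ^ 2) k] (mod 3)"
proof -
  \<comment> \<open>Any positive \<open>n\<close> with \<open>k \<le> 2*n\<close> is large enough for the truncations.\<close>
  define n where "n = Suc k"
  define R where "R = Abs_fps (\<lambda>n. int (overR 6 n))"
  define f1 where "f1 = (\<Prod>k\<in>{1..2*n}. 1 - fps_X ^ k :: int fps)"
  define f2 where "f2 = (\<Prod>k\<in>{1..n}. 1 - fps_X ^ (2*k) :: int fps)"
  define f6 where "f6 = (\<Prod>k\<in>{k\<in>{1..2*n}. 6 dvd k}. 1 - fps_X ^ k :: int fps)"
  let ?N = "Suc (2*n)"
  have f6: "cong_upto 3 ?N f6 (f2 ^ 3)"
  proof -
    have "{k\<in>{1..2*n}. 6 dvd k} \<subseteq> (*) 6 ` {1..n}" by (auto elim!: dvdE)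
    then have "cong_upto 3 ?N (\<Prod>k\<in>(*) 6 ` {1..n}. 1 - fps_X ^ k) f6"
      unfolding f6_def by (intro cong_upto_prod_truncate) auto
    moreover have "(\<Prod>k\<in>(*) 6 ` {1..n}. 1 - fps_X ^ k :: int fps) = (\<Prod>k\<in>{1..n}. 1 - fps_X ^ (3 * (2*k)))"
      by (subst prod.reindex) (auto simp: inj_on_def)
    moreover have "cong_upto 3 ?N (f2 ^ 3) (\<Prod>k\<in>{1..n}. 1 - fps_X ^ (3 * (2*k)))"
      unfolding f2_def by (rule cong_upto_prod_cube)
    ultimately show ?thesis by (metis cong_upto_sym cong_upto_trans)
  qed
  have f2: "cong_upto 3 ?N (\<Prod>k\<in>{1..2*n}. 1 - fps_X ^ (2*k)) f2"
    unfolding f2_def by (rule cong_upto_prod_truncate) auto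
  have "R * f1 ^ 2 = R * (\<Prod>k\<in>{k\<in>{1..2*n}. \<not> 6 dvd k}. 1 - fps_X ^ k) * (f6 * f1)"
  proof -
    have "f1 = (\<Prod>k\<in>{k\<in>{1..2*n}. \<not> 6 dvd k}. 1 - fps_X ^ k) * f6"
      unfolding f1_def f6_def
      by (subst prod.union_disjoint [symmetric]) (auto intro: prod.cong)
    then show ?thesis by (simp add: power2_eq_square mult_ac)
  qed
  also have "cong_upto 3 ?N \<dots> ((\<Prod>k\<in>{1..2*n}. 1 + fps_X ^ k) * (f6 * f1))"
    unfolding R_def by (intro cong_upto_mult cong_upto_exact[OF overR_fps_product] cong_upto_refl)
  also have "(\<Prod>k\<in>{1..2*n}. 1 + fps_X ^ k) * (f6 * f1) = (\<Prod>k\<in>{1..2*n}. 1 - fps_X ^ (2*k)) * f6"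
  proof -
    have "(1 + x) * (1 - x) = 1 - x * x" for x :: "int fps"
      by (simp add: algebra_simps)
    then have "(1 + fps_X ^ k) * (1 - fps_X ^ k) = (1 - fps_X ^ (2*k) :: int fps)" for k
      by (simp only: mult_2 power_add)
    then have "(\<Prod>k\<in>{1..2*n}. 1 + fps_X ^ k) * f1 = (\<Prod>k\<in>{1..2*n}. 1 - fps_X ^ (2*k))"
      by (simp only: f1_def prod.distrib [symmetric])
    then show ?thesis by (simp add: mult_ac)
  qed
  also have "cong_upto 3 ?N \<dots> (f2 * f2 ^ 3)"
    by (rule cong_upto_mult[OF f2 f6])
  also have "f2 * f2 ^ 3 = f2 ^ 2 * f2 ^ 2"
    by (simp flip: power_Suc power_add)
  also have "cong_upto 3 ?N \<dots> ((ramanujan_psi * f1) * (ramanujan_psi * f1))"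
  proof -
    have "0 < n" by (simp add: n_def)
    then have "cong_upto 0 ?N (ramanujan_psi * f1) (f2 ^ 2)"
      unfolding f1_def f2_def Suc_eq_plus1 by (rule ramanujan_psi_product)
    then have "cong_upto 3 ?N (f2 ^ 2) (ramanujan_psi * f1)"
      by (rule cong_upto_sym[OF cong_upto_exact])
    then show ?thesis by (rule cong_upto_mult) fact
  qed
  finally have "cong_upto 3 ?N (f1 ^ 2 * R) (f1 ^ 2 * ramanujan_psi ^ 2)"
    by (simp add: power2_eq_square mult_ac)
  moreover have "fps_nth (f1 ^ 2) 0 = 1"
  proof -
    have "fps_nth (\<Prod>a\<in>A. 1 - fps_X ^ a) 0 = (1::int)" if "0 \<notin> A" for A :: "nat set"
      using that by (induction A rule: infinite_finite_induct) auto
    then show ?thesis by (simp add: f1_def fps_power_zeroth)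
  qed
  ultimately have "cong_upto 3 ?N R (ramanujan_psi ^ 2)"
    by (rule cong_upto_cancel[rotated])
  then show ?thesis by (simp add: cong_upto_def R_def n_def)
qed

section \<open>Theta products and sums of two squares\<close>

lemma fps_mult_indicators_nth:
  fixes f g :: "nat \<Rightarrow> nat"
  assumes "inj f" and "inj g"
    and F: "\<And>k. fps_nth F k = of_bool (k \<in> range f)" and G: "\<And>k. fps_nth G k = of_bool (k \<in> range g)"
  shows "fps_nth (F * G) n = int (card {(i, j). f i + g j = n})"
proof -
  let ?K = "{k \<in> {0..n}. k \<in> range f \<and> n - k \<in> range g}"
  have "fps_nth (F * G) n = (\<Sum>k=0..n. if k \<in> range f \<and> n - k \<in> range g then 1 else 0)"
    unfolding fps_mult_nth F G by (rule sum.cong) auto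
  also have "\<dots> = int (card ?K)"
    by (simp add: sum.If_cases Int_def)
  also have "card ?K = card {(i, j). f i + g j = n}"
  proof -
    have "bij_betw (\<lambda>(i, j). f i) {(i, j). f i + g j = n} ?K"
      unfolding bij_betw_def
    proof
      have unique: "i = i' \<and> j = j'" if "f i + g j = n" "f i' + g j' = n" "f i = f i'" for i j i' j'
      proof -
        have "g j = g j'" using that by linarith
        with that(3) show ?thesis using assms(1,2) by (simp add: inj_eq)
      qed
      show "inj_on (\<lambda>(i, j). f i) {(i, j). f i + g j = n}"
      proof (rule inj_onI)
        fix z z' assume "z \<in> {(i, j). f i + g j = n}" "z' \<in> {(i, j). f i + g j = n}"
          "(case z of (i, j) \<Rightarrow> f i) = (case z' of (i, j) \<Rightarrow> f i)"
        then show "z = z'"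
          using unique[of "fst z" "snd z" "fst z'" "snd z'"] by (simp add: case_prod_unfold prod_eq_iff)
      qed
      show "(\<lambda>(i, j). f i) ` {(i, j). f i + g j = n} = ?K"
      proof (intro equalityI subsetI)
        fix k assume "k \<in> ?K"
        then obtain i j where "k = f i" "n - k = g j" "k \<le> n" by auto
        then have "(i, j) \<in> {(i, j). f i + g j = n}" "k = (\<lambda>(i, j). f i) (i, j)" by auto
        then show "k \<in> (\<lambda>(i, j). f i) ` {(i, j). f i + g j = n}" by blast
      qed auto
    qed
    then show ?thesis by (rule bij_betw_same_card [symmetric])
  qed
  finally show ?thesis .
qed

definition triangle :: "nat \<Rightarrow> nat" where
  "triangle i = i * (i + 1) div 2"

lemma triangle_odd_square: "8 * triangle i + 1 = (2*i + 1) ^ 2"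
proof -
  have "2 * triangle i = i * (i + 1)" by (simp add: triangle_def)
  then have "8 * triangle i + 1 = 4 * (i * (i + 1)) + 1" by linarith
  then show ?thesis by (simp add: power2_eq_square algebra_simps)
qed

lemma inj_triangle: "inj triangle"
proof (rule injI)
  fix i j assume "triangle i = triangle j"
  then have "(2*i + 1) ^ 2 = (2*j + 1) ^ 2" by (simp only: triangle_odd_square [symmetric])
  then show "i = j" by simp
qed

lemma ramanujan_psi_nth_triangle: "fps_nth ramanujan_psi k = of_bool (k \<in> range triangle)"
proof -
  have "fps_nth ramanujan_psi k = (\<Sum>\<nu><Suc k. if k = triangle \<nu> then 1 else (0::int))"
    using ramanujan_psi_nth[of k "Suc k"] by (simp only: lessI fps_sum_nth fps_X_power_nth triangle_def)
  also have "\<dots> = (\<Sum>\<nu>\<in>{\<nu>\<in>{..<Suc k}. triangle \<nu> = k}. 1)"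
    by (subst sum.inter_filter) (auto intro: sum.cong)
  also have "\<dots> = of_bool (k \<in> range triangle)"
  proof (cases "k \<in> range triangle")
    case True
    then obtain i where i: "k = triangle i" by blast
    have "i \<le> triangle i"
    proof -
      have "(2*i + 1)^2 = 4 * (i * i) + 4 * i + 1" by (simp add: power2_eq_square)
      then show ?thesis using triangle_odd_square[of i] le_square[of i] by linarith
    qed
    then have "{\<nu>\<in>{..<Suc k}. triangle \<nu> = k} = {i}"
      unfolding i by (auto simp: inj_eq[OF inj_triangle])
    with True show ?thesis by simp
  next
    case False
    then have "{\<nu>\<in>{..<Suc k}. triangle \<nu> = k} = {}" by auto
    with False show ?thesis by simp
  qed
  finally show ?thesis .
qed

definition odd_square_reps :: "nat \<Rightarrow> nat" where
  "odd_square_reps N = card {(a, b). odd a \<and> odd b \<and> a^2 + b^2 = N}"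

definition mixed_square_reps :: "nat \<Rightarrow> nat" where
  "mixed_square_reps N = card {(x, y). odd x \<and> even y \<and> x^2 + y^2 = N}"

lemma psi_square_nth: "fps_nth (ramanujan_psi ^ 2) k = int (odd_square_reps (8*k + 2))"
proof -
  let ?h = "\<lambda>(i::nat, j::nat). (2*i + 1, 2*j + 1)"
  have rep: "triangle i + triangle j = k \<longleftrightarrow> (2*i + 1)^2 + (2*j + 1)^2 = 8*k + 2" for i j
    using triangle_odd_square[of i] triangle_odd_square[of j] by linarith
  have image: "?h ` {(i, j). triangle i + triangle j = k} = {(a, b). odd a \<and> odd b \<and> a^2 + b^2 = 8*k + 2}"
  proof (intro equalityI subsetI)
    fix z assume "z \<in> ?h ` {(i, j). triangle i + triangle j = k}"
    then obtain i j where z: "z = (2*i + 1, 2*j + 1)" "triangle i + triangle j = k" by auto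
    show "z \<in> {(a, b). odd a \<and> odd b \<and> a^2 + b^2 = 8*k + 2}"
      unfolding z(1) using z(2)[unfolded rep] by (simp only: mem_Collect_eq case_prod_conv) simp
  next
    fix z :: "nat \<times> nat" assume z: "z \<in> {(a, b). odd a \<and> odd b \<and> a^2 + b^2 = 8*k + 2}"
    then obtain i j where ij: "z = ?h (i, j)" by (auto elim!: oddE)
    with z have "triangle i + triangle j = k" unfolding rep by simp
    with ij show "z \<in> ?h ` {(i, j). triangle i + triangle j = k}" by blast
  qed
  have "odd_square_reps (8*k + 2) = card {(i, j). triangle i + triangle j = k}"
    unfolding odd_square_reps_def image [symmetric] by (rule card_image) (auto simp: inj_on_def)
  then show ?thesis
    using fps_mult_indicators_nth[OF inj_triangle inj_triangle ramanujan_psi_nth_triangle ramanujan_psi_nth_triangle]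
    by (simp add: power2_eq_square)
qed

text \<open>Here $8(T_i + 4T_j) + 5 = (2i+1)^2 + (4j+2)^2$. Conversely, the even member of a representation of
  $8m+5$ is not divisible by 4, as an odd square is 1 modulo 8.\<close>
lemma psi_psi_q4_nth:
  "fps_nth (ramanujan_psi * (ramanujan_psi oo fps_X ^ 4)) m = int (mixed_square_reps (8*m + 5))"
proof -
  let ?h = "\<lambda>(i::nat, j::nat). (2*i + 1, 4*j + 2)"
  have rep: "triangle i + 4 * triangle j = m \<longleftrightarrow> (2*i + 1)^2 + (4*j + 2)^2 = 8*m + 5" for i j
  proof -
    have "(4*j + 2)^2 = 4 * (2*j + 1)^2" by (simp add: power2_eq_square algebra_simps)
    then show ?thesis
      using triangle_odd_square[of i] triangle_odd_square[of j] by linarith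
  qed
  have image: "?h ` {(i, j). triangle i + 4 * triangle j = m} = {(x, y). odd x \<and> even y \<and> x^2 + y^2 = 8*m + 5}"
  proof (intro equalityI subsetI)
    fix z assume "z \<in> ?h ` {(i, j). triangle i + 4 * triangle j = m}"
    then obtain i j where z: "z = (2*i + 1, 4*j + 2)" "triangle i + 4 * triangle j = m" by auto
    show "z \<in> {(x, y). odd x \<and> even y \<and> x^2 + y^2 = 8*m + 5}"
      unfolding z(1) using z(2)[unfolded rep] by (simp only: mem_Collect_eq case_prod_conv) simp
  next
    fix z :: "nat \<times> nat" assume z: "z \<in> {(x, y). odd x \<and> even y \<and> x^2 + y^2 = 8*m + 5}"
    then obtain i y where iy: "z = (2*i + 1, 2*y)" by (auto elim!: oddE evenE)
    have "odd y"
    proof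
      assume "even y"
      then obtain u where "y = 2*u" by blast
      then have "(2*i + 1)^2 + 16 * u^2 = 8*m + 5" using z iy by (simp add: power2_eq_square)
      then have "8 * triangle i + 1 + 16 * u^2 = 8*m + 5" by (simp only: triangle_odd_square)
      then show False by presburger
    qed
    then obtain j where "y = 2*j + 1" by (rule oddE)
    then have ij: "z = ?h (i, j)" using iy by simp
    with z have "triangle i + 4 * triangle j = m" unfolding rep by simp
    with ij show "z \<in> ?h ` {(i, j). triangle i + 4 * triangle j = m}" by blast
  qed
  have card: "mixed_square_reps (8*m + 5) = card {(i, j). triangle i + 4 * triangle j = m}"
    unfolding mixed_square_reps_def image [symmetric] by (rule card_image) (auto simp: inj_on_def)
  have "fps_nth (ramanujan_psi oo fps_X ^ 4) k = of_bool (k \<in> range (\<lambda>j. 4 * triangle j))" for k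
    unfolding fps_nth_compose_X_power ramanujan_psi_nth_triangle by (auto elim!: dvdE)
  moreover have "inj (\<lambda>j. 4 * triangle j)"
    using inj_triangle by (simp add: inj_def)
  ultimately show ?thesis
    unfolding card by (intro fps_mult_indicators_nth inj_triangle ramanujan_psi_nth_triangle)
qed

text \<open>The map $(x, y) \mapsto (x + y, |x - y|)$ is a bijection from the representations of \<open>M\<close> by an
  odd and an even square onto the representations $(a, b)$ of \<open>2*M\<close> with $a > b$; swapping gives
  those with $a < b$. Since \<open>M\<close> is not a square, there are none with $a = b$, and \<open>y\<close> is never 0,
  so that the image does satisfy $a > b$.\<close>
lemma odd_square_reps_double:
  assumes "odd M" and not_square: "\<And>c. c ^ 2 \<noteq> M"
  shows "odd_square_reps (2*M) = 2 * mixed_square_reps M"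
proof -
  let ?L = "{(a, b). odd a \<and> odd b \<and> a^2 + b^2 = 2*M}"
  let ?gt = "{(a, b). odd a \<and> odd b \<and> a^2 + b^2 = 2*M \<and> b < a}"
  let ?lt = "{(a, b). odd a \<and> odd b \<and> a^2 + b^2 = 2*M \<and> a < b}"
  let ?mixed = "{(x, y). odd x \<and> even y \<and> x^2 + y^2 = M}"
  \<comment> \<open>With truncated subtraction, \<open>(x - y) + (y - x)\<close> is the distance of \<open>x\<close> and \<open>y\<close>.\<close>
  let ?h = "\<lambda>(x::nat, y::nat). (x + y, (x - y) + (y - x))"
  have squares: "(x + y)^2 + ((x - y) + (y - x))^2 = 2 * (x^2 + y^2)" for x y :: nat
  proof (cases "x \<le> y")
    case True
    then obtain d where "y = x + d" using le_Suc_ex by blast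
    then show ?thesis by (simp add: power2_eq_square algebra_simps)
  next
    case False
    then obtain d where "x = y + d" using le_Suc_ex nat_le_linear by blast
    then show ?thesis by (simp add: power2_eq_square algebra_simps)
  qed
  have "bij_betw ?h ?mixed ?gt"
    unfolding bij_betw_def
  proof
    have unique: "x = x' \<and> y = y'" if "odd x" "even y" "odd x'" "even y'"
      and "x + y = x' + y'" "(x - y) + (y - x) = (x' - y') + (y' - x')" for x y x' y' :: nat
    proof -
      have "x = x' \<and> y = y' \<or> x = y' \<and> y = x'" using that(5,6) by arith
      with that(1-4) show ?thesis by blast
    qed
    show "inj_on ?h ?mixed"
    proof (rule inj_onI)
      fix z z' assume "z \<in> ?mixed" "z' \<in> ?mixed" "?h z = ?h z'"
      then show "z = z'"
        using unique[of "fst z" "snd z" "fst z'" "snd z'"] by (simp add: case_prod_unfold prod_eq_iff)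
    qed
    show "?h ` ?mixed = ?gt"
    proof (intro equalityI subsetI)
      fix z assume "z \<in> ?h ` ?mixed"
      then obtain x y where z: "z = (x + y, (x - y) + (y - x))"
        and xy: "odd x" "even y" "x^2 + y^2 = M" by auto
      have "y \<noteq> 0" using xy(3) not_square[of x] by (intro notI) simp
      moreover have "x \<noteq> 0" using xy(1) by (intro notI) simp
      ultimately have "(x - y) + (y - x) < x + y" by arith
      moreover have "odd (x + y)" using xy(1,2) by simp
      moreover have "odd ((x - y) + (y - x))" using xy(1,2) by (cases "x \<le> y") auto
      ultimately show "z \<in> ?gt" using z squares[of x y] xy(3) by simp
    next
      fix z assume "z \<in> ?gt"
      then obtain a b where z: "z = (a, b)" and ab: "odd a" "odd b" "a^2 + b^2 = 2*M" "b < a"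
        by auto
      have "even (a - b)" using ab by simp
      then obtain v where v: "a = b + 2*v" using ab(4)
        by (metis dvd_def le_add_diff_inverse less_imp_le_nat)
      define u where "u = b + v"
      have uv: "a = u + v" "b = (u - v) + (v - u)" using v by (simp_all add: u_def)
      have sum: "u^2 + v^2 = M" using ab(3) squares[of u v] unfolding uv [symmetric] by simp
      have "odd u \<noteq> odd v" using assms(1) unfolding sum [symmetric] by auto
      then have "(u, v) \<in> ?mixed \<or> (v, u) \<in> ?mixed" using sum by auto
      moreover have "z = ?h (u, v)" "z = ?h (v, u)"
        unfolding z uv by (simp_all add: add.commute)
      ultimately show "z \<in> ?h ` ?mixed" by blast
    qed
  qed
  then have card_gt: "card ?gt = mixed_square_reps M"
    unfolding mixed_square_reps_def by (rule bij_betw_same_card [symmetric])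
  have "bij_betw prod.swap ?gt ?lt"
    by (rule bij_betw_byWitness[where f' = prod.swap]) auto
  then have card_lt: "card ?lt = mixed_square_reps M"
    by (rule bij_betw_same_card [THEN sym, THEN trans]) (rule card_gt)
  have "a \<noteq> b" if "a^2 + b^2 = 2*M" for a b
    using that not_square[of a] by (intro notI) simp
  then have neq: "a < b \<or> b < a" if "a^2 + b^2 = 2*M" for a b
    using that by (simp add: nat_neq_iff [symmetric])
  have L: "?L = ?gt \<union> ?lt"
  proof (rule Set.set_eqI)
    fix z :: "nat \<times> nat"
    show "z \<in> ?L \<longleftrightarrow> z \<in> ?gt \<union> ?lt"
      using neq[of "fst z" "snd z"] by (cases z) auto
  qed
  have "finite ?L"
  proof (rule finite_subset)
    have bounded: "k \<le> 2*M" if "k^2 \<le> 2*M" for k :: nat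
      using that self_le_power[of k 2] by (cases "k = 0") simp_all
    show "?L \<subseteq> {..2*M} \<times> {..2*M}"
    proof (rule subsetI)
      fix z assume "z \<in> ?L"
      then obtain a b where z: "z = (a, b)" and ab: "a^2 + b^2 = 2*M" by blast
      have "a \<le> 2*M" by (rule bounded) (simp add: ab [symmetric])
      moreover have "b \<le> 2*M" by (rule bounded) (simp add: ab [symmetric])
      ultimately show "z \<in> {..2*M} \<times> {..2*M}" by (simp add: z)
    qed
  qed simp
  then have "finite ?gt" "finite ?lt" unfolding L by simp_all
  then have "card ?L = card ?gt + card ?lt"
    unfolding L by (intro card_Un_disjoint) auto
  then show ?thesis
    unfolding odd_square_reps_def card_gt card_lt by simp
qed

section \<open>Descent along a prime for which -1 is a nonresidue\<close>

text \<open>If \<open>b\<close> had an inverse \<open>c\<close> modulo \<open>p\<close>, then \<open>a * c\<close> would be a square root of \<open>-1\<close>.\<close>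
lemma sum_two_squares_dvd_nonresidue:
  fixes p a b :: nat
  assumes "prime p" and "Legendre (-1) (int p) = -1" and "p dvd a^2 + b^2"
  shows "p dvd a" and "p dvd b"
proof -
  show b: "p dvd b"
  proof (rule ccontr)
    assume "\<not> p dvd b"
    then have "coprime p b" by (rule prime_imp_coprime[OF assms(1)])
    then have "coprime (int b) (int p)" by (simp add: coprime_commute)
    then obtain c where c: "[int b * c = 1] (mod int p)"
      using cong_solve_coprime_int by blast
    have "[int (a^2 + b^2) * c^2 = 0] (mod int p)"
      using assms(3) by (simp only: cong_0_iff int_dvd_int_iff dvd_mult2)
    then have "[(int a * c)^2 + (int b * c)^2 = 0] (mod int p)"
      by (simp add: power_mult_distrib distrib_right)
    moreover have "[(int b * c)^2 = 1] (mod int p)"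
      using cong_pow[OF c, of 2] by simp
    ultimately have "[(int a * c)^2 + (int b * c)^2 - (int b * c)^2 = 0 - 1] (mod int p)"
      by (rule cong_diff)
    then have "QuadRes (int p) (-1)"
      unfolding QuadRes_def by auto
    then show False
      using assms(2) by (simp add: Legendre_def split: if_splits)
  qed
  have "p dvd b^2" using b by (simp add: power2_eq_square)
  then have "p dvd a^2" using assms(3) by (simp add: dvd_add_left_iff)
  then show "p dvd a" using assms(1) by (rule prime_dvd_power[rotated])
qed

lemma odd_square_reps_mult_square:
  assumes "prime p" and "odd p" and "Legendre (-1) (int p) = -1"
  shows "odd_square_reps (p^2 * N) = odd_square_reps N"
proof -
  let ?h = "\<lambda>(a, b). (p * a, p * b)"
  have image: "?h ` {(a, b). odd a \<and> odd b \<and> a^2 + b^2 = N} = {(a, b). odd a \<and> odd b \<and> a^2 + b^2 = p^2 * N}"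
  proof (intro equalityI subsetI)
    fix z assume "z \<in> ?h ` {(a, b). odd a \<and> odd b \<and> a^2 + b^2 = N}"
    then show "z \<in> {(a, b). odd a \<and> odd b \<and> a^2 + b^2 = p^2 * N}"
      using assms(2) by (auto simp: power_mult_distrib distrib_left)
  next
    fix z assume "z \<in> {(a, b). odd a \<and> odd b \<and> a^2 + b^2 = p^2 * N}"
    then obtain a b where z: "z = (a, b)" and ab: "odd a" "odd b" "a^2 + b^2 = p^2 * N" by auto
    have "p dvd a^2 + b^2" unfolding ab(3) by (simp add: power2_eq_square)
    then have "p dvd a" "p dvd b"
      using sum_two_squares_dvd_nonresidue[OF assms(1,3)] by blast+
    then obtain c d where cd: "a = p * c" "b = p * d" by (auto elim!: dvdE)
    have "p^2 * (c^2 + d^2) = p^2 * N"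
      using ab(3) unfolding cd by (simp add: power_mult_distrib distrib_left)
    then have "c^2 + d^2 = N"
      using assms(1) by (simp add: prime_gt_0_nat)
    moreover have "odd c" "odd d" using ab(1,2) unfolding cd by simp_all
    ultimately have "(c, d) \<in> {(a, b). odd a \<and> odd b \<and> a^2 + b^2 = N}" by simp
    moreover have "z = ?h (c, d)" by (simp add: z cd)
    ultimately show "z \<in> ?h ` {(a, b). odd a \<and> odd b \<and> a^2 + b^2 = N}" by blast
  qed
  have "0 < p" using assms(1) by (rule prime_gt_0_nat)
  then show ?thesis
    unfolding odd_square_reps_def image [symmetric]
    by (intro card_image) (auto simp: inj_on_def)
qed

lemma odd_square_reps_mult_even_power:
  assumes "prime p" and "odd p" and "Legendre (-1) (int p) = -1"
  shows "odd_square_reps (p ^ (2 * \<alpha>) * N) = odd_square_reps N"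
proof (induction \<alpha>)
  case (Suc \<alpha>)
  have "p ^ (2 * Suc \<alpha>) * N = p^2 * (p ^ (2 * \<alpha>) * N)"
    by (simp add: power2_eq_square mult_ac)
  then show ?case
    using odd_square_reps_mult_square[OF assms] Suc.IH by (simp only:)
qed simp

text \<open>In a representation, \<open>p\<close> would divide both members, hence \<open>p^2\<close> would divide \<open>p * N\<close>.\<close>
lemma odd_square_reps_exact_multiple:
  assumes "prime p" and "Legendre (-1) (int p) = -1" and "\<not> p dvd N"
  shows "odd_square_reps (p * N) = 0"
proof -
  have False if "a^2 + b^2 = p * N" for a b
  proof -
    have "p dvd a^2 + b^2" unfolding that by simp
    then have "p dvd a" "p dvd b"
      using sum_two_squares_dvd_nonresidue[OF assms(1,2)] by blast+
    then have "p^2 dvd a^2 + b^2" by (simp add: dvd_add dvd_power_same)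
    then have "p * p dvd p * N" unfolding that by (simp only: power2_eq_square)
    then show False
      using assms(1,3) by (simp add: prime_gt_0_nat)
  qed
  then have "{(a, b). odd a \<and> odd b \<and> a^2 + b^2 = p * N} = {}" by blast
  then show ?thesis unfolding odd_square_reps_def by (simp only: card.empty)
qed

section \<open>The congruences\<close>

lemma overR_6_cong_odd_square_reps:
  "[int (overR 6 k) = int (odd_square_reps (8*k + 2))] (mod 3)"
  using overR_6_cong_psi_square unfolding psi_square_nth .

text \<open>The division by 4 in the theorem is exact because \<open>p ^ (2 * \<alpha>)\<close> is an odd square.\<close>
lemma odd_square_reps_index:
  fixes p :: nat
  assumes "odd p"
  shows "8 * (A + (5 * p ^ (2 * \<alpha>) - 1) div 4) + 2 = 8 * A + 10 * p ^ (2 * \<alpha>)"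
proof -
  have "[p ^ (2 * \<alpha>) = 1] (mod 4)"
  proof -
    obtain i where "p = 2*i + 1" using assms by (rule oddE)
    then have "p^2 = 4 * (i^2 + i) + 1" by (simp add: power2_eq_square algebra_simps)
    then have "[p^2 = 1] (mod 4)" by (simp add: cong_def)
    then show ?thesis unfolding power_mult using cong_pow by fastforce
  qed
  then have "p ^ (2 * \<alpha>) mod 4 = 1" by (simp add: cong_def)
  then show ?thesis by presburger
qed

lemma five_mod_8_not_square: "c ^ 2 \<noteq> 8*m + (5::nat)"
proof
  assume c: "c ^ 2 = 8*m + 5"
  then have "odd (c ^ 2)" by simp
  then obtain i where "c = 2*i + 1" by (auto elim: oddE)
  then have "4 * (i^2 + i) + 1 = 8*m + 5" using c by (simp add: power2_eq_square algebra_simps)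
  moreover have "even (i^2 + i)" by simp
  ultimately show False by presburger
qed

theorem theorem3p4:
  fixes p r \<alpha> n :: nat
  assumes "prime p" and "p \<ge> 3" and "Legendre (-1) (int p) = -1"
    and "1 \<le> r" and "r \<le> p - 1"
  shows "fps_cong
           (Abs_fps (\<lambda>m. int (overR 6 (2 * p ^ (2 * \<alpha>) * m + (5 * p ^ (2 * \<alpha>) - 1) div 4))))
           (2 * ramanujan_psi * (ramanujan_psi oo fps_X ^ 4)) 3
         \<and> [overR 6 (2 * p ^ (2 * \<alpha> + 1) * (p * n + r) + (5 * p ^ (2 * \<alpha> + 2) - 1) div 4) = 0] (mod 3)"
proof
  have "odd p" using assms(1,2) by (intro prime_odd_nat) auto
  note descent = odd_square_reps_mult_even_power[OF assms(1) \<open>odd p\<close> assms(3)]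
  show "fps_cong
           (Abs_fps (\<lambda>m. int (overR 6 (2 * p ^ (2 * \<alpha>) * m + (5 * p ^ (2 * \<alpha>) - 1) div 4))))
           (2 * ramanujan_psi * (ramanujan_psi oo fps_X ^ 4)) 3"
    unfolding fps_cong_def
  proof
    fix m
    let ?k = "2 * p ^ (2 * \<alpha>) * m + (5 * p ^ (2 * \<alpha>) - 1) div 4"
    have "8 * ?k + 2 = p ^ (2 * \<alpha>) * (2 * (8*m + 5))"
      unfolding odd_square_reps_index[OF \<open>odd p\<close>] by (simp add: algebra_simps)
    then have "odd_square_reps (8 * ?k + 2) = odd_square_reps (2 * (8*m + 5))"
      using descent by (simp only:)
    also have "\<dots> = 2 * mixed_square_reps (8*m + 5)"
      by (rule odd_square_reps_double[OF _ five_mod_8_not_square]) simp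
    finally have "int (odd_square_reps (8 * ?k + 2)) =
        fps_nth (2 * ramanujan_psi * (ramanujan_psi oo fps_X ^ 4)) m"
      by (simp add: mult.assoc psi_psi_q4_nth numeral_fps_const)
    then show "[fps_nth (Abs_fps (\<lambda>m. int (overR 6 (2 * p ^ (2 * \<alpha>) * m + (5 * p ^ (2 * \<alpha>) - 1) div 4)))) m =
        fps_nth (2 * ramanujan_psi * (ramanujan_psi oo fps_X ^ 4)) m] (mod 3)"
      using overR_6_cong_odd_square_reps[of ?k] by simp
  qed
  let ?k = "2 * p ^ (2 * \<alpha> + 1) * (p * n + r) + (5 * p ^ (2 * \<alpha> + 2) - 1) div 4"
  let ?N = "16 * (p * n + r) + 10 * p"
  have "\<not> p dvd ?N"
  proof
    assume "p dvd ?N"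
    moreover have "?N = 16 * r + p * (16 * n + 10)" by (simp add: algebra_simps)
    ultimately have "p dvd 16 * r" by (metis dvd_add_left_iff dvd_triv_left)
    then have "p dvd 2 ^ 4 \<or> p dvd r"
      using assms(1) by (simp add: prime_dvd_mult_iff)
    moreover have "\<not> p dvd 2 ^ 4"
      using prime_dvd_power[OF assms(1), of 2 4] dvd_imp_le[of p 2] assms(2) by auto
    moreover have "\<not> p dvd r"
      using assms(2,4,5) by (intro notI) (auto dest: dvd_imp_le)
    ultimately show False by blast
  qed
  then have "odd_square_reps (p * ?N) = 0"
    by (rule odd_square_reps_exact_multiple[OF assms(1,3)])
  moreover have "8 * ?k + 2 = p ^ (2 * \<alpha>) * (p * ?N)"
  proof -
    have "2 * \<alpha> + 2 = 2 * (\<alpha> + 1)" by simp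
    then have "8 * ?k + 2 = 8 * (2 * p ^ (2 * \<alpha> + 1) * (p * n + r)) + 10 * p ^ (2 * (\<alpha> + 1))"
      using odd_square_reps_index[OF \<open>odd p\<close>] by (simp only:)
    then show ?thesis by (simp add: algebra_simps power2_eq_square)
  qed
  ultimately have "odd_square_reps (8 * ?k + 2) = 0"
    using descent by (simp only:)
  then have "[int (overR 6 ?k) = int 0] (mod int 3)"
    using overR_6_cong_odd_square_reps[of ?k] by simp
  then show "[overR 6 ?k = 0] (mod 3)"
    by (simp only: cong_int_iff)
qed

end
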